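(* Let $\mathscr{H}$ be a real Hilbert space, let $f:\mathscr{H}\to\mathbb{R}\cup\{+\infty\}$ be closed, convex and proper, and let $\mathcal{S}:\mathscr{H}\to\mathscr{H}$ be a bijective, linear and continuous operator. Then the operator $\mathbf{Prox}_{f\mathcal{S}}$ defined by $$\mathbf{Prox}_{f\mathcal{S}}(\bm{v})=\operatorname*{argmin}_{\bm{z}\in\mathscr{H}}\; f(\mathcal{S}\bm{z})+\tfrac12\|\bm{z}-\bm{v}\|^2$$ is single-valued and firmly nonexpansive.
   Context: An operator $\mathcal{T}:\mathscr{H}\to\mathscr{H}$ is firmly nonexpansive if $\|\mathcal{T}\bm{x}-\mathcal{T}\bm{y}\|^2\le\langle\mathcal{T}\bm{x}-\mathcal{T}\bm{y},\bm{x}-\bm{y}\rangle$ for all $\bm{x},\bm{y}\in\mathscr{H}$. Single-valued means that for every $\bm{v}\in\mathscr{H}$ the set of minimizers consists of exactly one point. *)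

theory Defs
  imports "HOL-Analysis.Analysis"
begin

text \<open>Functions into \<open>\<real> \<union> {+\<infinity>}\<close> are functions into \<^typ>\<open>ereal\<close> that avoid \<open>-\<infinity>\<close>;
  this exclusion is part of \<open>proper_fun\<close>.\<close>

definition proper_fun :: "('a \<Rightarrow> ereal) \<Rightarrow> bool" where
  "proper_fun f \<longleftrightarrow> (\<forall>x. f x \<noteq> -\<infinity>) \<and> (\<exists>x. f x \<noteq> \<infinity>)"

text \<open>On \<^typ>\<open>ereal\<close> we have \<open>\<infinity> + (-\<infinity>) = \<infinity>\<close>; the definition is only meant for functions that avoid
  \<open>-\<infinity>\<close>, where it is the usual convexity inequality. (\<^const>\<open>convex_on\<close> only covers real-valued functions.)\<close>

definition convex_fun :: "('a::real_vector \<Rightarrow> ereal) \<Rightarrow> bool" where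
  "convex_fun f \<longleftrightarrow>
     (\<forall>x y. \<forall>t::real. 0 < t \<and> t < 1 \<longrightarrow>
        f ((1 - t) *\<^sub>R x + t *\<^sub>R y) \<le> ereal (1 - t) * f x + ereal t * f y)"

text \<open>A function is closed if its epigraph, a subset of \<open>H \<times> \<real>\<close>, is closed.\<close>

definition closed_fun :: "('a::topological_space \<Rightarrow> ereal) \<Rightarrow> bool" where
  "closed_fun f \<longleftrightarrow> closed {(x, r::real). f x \<le> ereal r}"

definition Prox :: "('a::real_inner \<Rightarrow> ereal) \<Rightarrow> ('a \<Rightarrow> 'a) \<Rightarrow> 'a \<Rightarrow> 'a set" where
  "Prox f S v =
     {p. is_arg_min (\<lambda>z. f (S z) + ereal (1/2 * (norm (z - v))\<^sup>2)) (\<lambda>z. z \<in> UNIV) p}"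

definition single_valued_op :: "('a \<Rightarrow> 'a set) \<Rightarrow> bool" where
  "single_valued_op T \<longleftrightarrow> (\<forall>v. \<exists>p. T v = {p})"

definition firmly_nonexpansive :: "('a::real_inner \<Rightarrow> 'a) \<Rightarrow> bool" where
  "firmly_nonexpansive T \<longleftrightarrow> (\<forall>x y. (norm (T x - T y))\<^sup>2 \<le> (T x - T y) \<bullet> (x - y))"

end

theory Submission
  imports Defs
begin

text \<open>The composition \<open>g = f \<circ> S\<close> is again closed, convex and proper, so it suffices to treat the
  proximal operator of \<open>g\<close>. Lower semicontinuity of \<open>g\<close> at one point of its domain, propagated along
  rays by convexity, gives a minorant of the form \<open>a - C \<parallel>z - x\<^sub>0\<parallel>\<close>; hence the objective
  \<open>g z + \<parallel>z - v\<parallel>\<^sup>2 / 2\<close> is bounded below. By its strong convexity every minimizing sequence is Cauchy,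
  and closedness of the epigraph makes the limit a minimizer. A minimizer \<open>p\<close> satisfies
  \<open>g p \<le> g w + \<langle>p - v, w - p\<rangle>\<close> for all \<open>w\<close>; adding this inequality for two
  minimizers, each tested against the other, yields firm nonexpansiveness and, for equal \<open>v\<close>, uniqueness.\<close>

section \<open>Closed convex functions on their effective domain\<close>

text \<open>\<open>D\<close> models the effective domain of an extended-valued function and
  \<open>h\<close> its finite values there, so that all arithmetic stays in the reals.\<close>

locale closed_convex_real_fun =
  fixes D :: "'a::real_inner set" and h :: "'a \<Rightarrow> real"
  assumes nonempty: "D \<noteq> {}"
    and convex: "convex_on D h"
    and closed_epigraph: "closed {(x, r). x \<in> D \<and> h x \<le> r}"
begin

definition prox_obj :: "'a \<Rightarrow> 'a \<Rightarrow> real" where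
  "prox_obj v z = h z + 1/2 * (norm (z - v))\<^sup>2"

definition is_prox :: "'a \<Rightarrow> 'a \<Rightarrow> bool" where
  "is_prox v p \<longleftrightarrow> p \<in> D \<and> (\<forall>z\<in>D. prox_obj v p \<le> prox_obj v z)"

lemma segment_mem:
  assumes "x \<in> D" "y \<in> D" "0 \<le> t" "t \<le> 1"
  shows "x + t *\<^sub>R (y - x) \<in> D"
proof -
  have "convex D"
    using convex by (simp add: convex_on_def)
  then have "(1 - t) *\<^sub>R x + t *\<^sub>R y \<in> D"
    using assms by (simp add: convex_alt)
  then show ?thesis
    by (simp add: algebra_simps)
qed

lemma segment_le:
  assumes "x \<in> D" "y \<in> D" "0 \<le> t" "t \<le> 1"
  shows "h (x + t *\<^sub>R (y - x)) \<le> (1 - t) * h x + t * h y"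
proof -
  have "h ((1 - t) *\<^sub>R x + t *\<^sub>R y) \<le> (1 - t) * h x + t * h y"
    using convex_onD[OF convex, of t x y] assms by simp
  then show ?thesis
    by (simp add: algebra_simps)
qed

section \<open>Lower bounds for the objective\<close>

text \<open>\<open>(x, h x - 1)\<close> lies outside the closed epigraph, hence so does
  \<open>(w, h x - 1)\<close> for every \<open>w\<close> near \<open>x\<close>.\<close>

lemma lower_bound_near:
  assumes "x \<in> D"
  obtains \<delta> where "\<delta> > 0" "\<And>w. w \<in> D \<Longrightarrow> dist w x \<le> \<delta> \<Longrightarrow> h x - 1 \<le> h w"
proof -
  let ?U = "(\<lambda>w. (w, h x - 1)) -` (- {(x, r). x \<in> D \<and> h x \<le> r})"
  have "open ?U"
    using closed_epigraph by (intro open_vimage continuous_intros) (simp add: open_Compl)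
  moreover have "x \<in> ?U"
    by simp
  ultimately obtain \<delta> where "\<delta> > 0" "cball x \<delta> \<subseteq> ?U"
    using open_contains_cball_eq by blast
  then show thesis
    by (intro that[of \<delta>]) (auto simp: subset_iff dist_commute)
qed

text \<open>By convexity, too low a value at a distant \<open>z\<close> would pull \<open>h\<close>
  below \<open>h x - 1\<close> already at distance \<open>\<delta>\<close> from \<open>x\<close>.
  This gives the slope \<open>C = 1/\<delta>\<close>.\<close>

lemma conical_minorant:
  assumes "x \<in> D"
  obtains C where "C \<ge> 0" "\<And>z. z \<in> D \<Longrightarrow> h x - 1 - C * norm (z - x) \<le> h z"
proof -
  obtain \<delta> where \<delta>: "\<delta> > 0" "\<And>w. w \<in> D \<Longrightarrow> dist w x \<le> \<delta> \<Longrightarrow> h x - 1 \<le> h w"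
    using lower_bound_near[OF assms] by blast
  have "h x - 1 - 1/\<delta> * norm (z - x) \<le> h z" if "z \<in> D" for z
  proof (cases "norm (z - x) \<le> \<delta>")
    case True
    then have "h x - 1 \<le> h z"
      using \<delta>(2)[OF that] by (simp add: dist_norm)
    moreover have "0 \<le> 1/\<delta> * norm (z - x)"
      using \<delta>(1) by simp
    ultimately show ?thesis
      by linarith
  next
    case False
    \<comment> \<open>This \<open>t\<close> puts \<open>x + t *\<^sub>R (z - x)\<close> on the
      sphere of radius \<open>\<delta>\<close> around \<open>x\<close>.\<close>
    define t where "t = \<delta> / norm (z - x)"
    have t: "0 < t" "t \<le> 1"
      using False \<delta>(1) by (auto simp: t_def divide_le_eq_1 intro!: divide_pos_pos)
    have "norm (t *\<^sub>R (z - x)) = \<delta>"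
      using False \<delta>(1) by (auto simp: t_def)
    then have "h x - 1 \<le> h (x + t *\<^sub>R (z - x))"
      using t by (intro \<delta>(2) segment_mem assms that) (auto simp: dist_norm)
    also have "\<dots> \<le> (1 - t) * h x + t * h z"
      using t by (intro segment_le assms that) auto
    finally have "t * (h x - h z) \<le> 1"
      by (simp add: algebra_simps)
    then have "h x - h z \<le> 1 / t"
      using t by (simp add: field_simps)
    also have "1 / t = 1/\<delta> * norm (z - x)"
      by (simp add: t_def)
    finally show ?thesis
      by linarith
  qed
  then show thesis
    using \<delta>(1) by (intro that[of "1/\<delta>"]) auto
qed

lemma bdd_below_prox_obj: "bdd_below (prox_obj v ` D)"
proof -
  obtain x where x: "x \<in> D"
    using nonempty by blast
  obtain C where C: "C \<ge> 0" "\<And>z. z \<in> D \<Longrightarrow> h x - 1 - C * norm (z - x) \<le> h z"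
    using conical_minorant[OF x] by blast
  \<comment> \<open>Moving the apex of the cone from \<open>x\<close> to \<open>v\<close> costs
    \<open>C * norm (v - x)\<close>; absorbing the linear term into the quadratic one costs
    \<open>C\<^sup>2 / 2\<close>.\<close>
  have "h x - 1 - C * norm (v - x) - C\<^sup>2 / 2 \<le> prox_obj v z" if "z \<in> D" for z
  proof -
    have "norm (z - x) \<le> norm (z - v) + norm (v - x)"
      using norm_triangle_ineq[of "z - v" "v - x"] by simp
    then have "C * norm (z - x) \<le> C * norm (z - v) + C * norm (v - x)"
      using C(1) mult_left_mono by (fastforce simp: distrib_left)
    moreover have "C * norm (z - v) \<le> C\<^sup>2 / 2 + 1/2 * (norm (z - v))\<^sup>2"
      using sum_squares_bound[of C "norm (z - v)"] by simp
    ultimately show ?thesis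
      using C(2)[OF that] by (simp add: prox_obj_def)
  qed
  then show ?thesis
    by (rule bdd_belowI2)
qed

section \<open>Strong convexity and optimality\<close>

lemma midpoint_eq_segment: "midpoint x y = x + (1/2) *\<^sub>R (y - x)"
proof -
  have "(1 - 1/2) *\<^sub>R x + (1/2) *\<^sub>R y = x + (1/2) *\<^sub>R (y - x)"
    by (simp only: scaleR_diff_left scaleR_diff_right scaleR_one) simp
  then show ?thesis
    by (simp add: midpoint_def scaleR_add_right)
qed

text \<open>The parallelogram law gains \<open>1/4\<close> in the squared norm, which the factor
  \<open>1/2\<close> of the objective turns into \<open>1/8\<close>.\<close>

lemma prox_obj_midpoint:
  assumes "x \<in> D" "y \<in> D"
  shows "prox_obj v (midpoint x y) \<le> (prox_obj v x + prox_obj v y) / 2 - (norm (x - y))\<^sup>2 / 8"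
proof -
  have "(norm (midpoint x y - v))\<^sup>2
      = ((norm (x - v))\<^sup>2 + (norm (y - v))\<^sup>2) / 2 - (norm (x - y))\<^sup>2 / 4"
    unfolding midpoint_eq_segment power2_norm_eq_inner
    by (simp add: inner_simps inner_commute field_simps)
  moreover have "h (midpoint x y) \<le> (h x + h y) / 2"
    using segment_le[OF assms, of "1/2"] by (simp add: midpoint_eq_segment)
  ultimately show ?thesis
    unfolding prox_obj_def by argo
qed

text \<open>First-order optimality: \<open>v - p\<close> is a subgradient of \<open>h\<close> at
  \<open>p\<close>. Compare \<open>p\<close> with \<open>p + t *\<^sub>R (w - p)\<close>, divide by
  \<open>t\<close> and let \<open>t\<close> tend to \<open>0\<close> from the right.\<close>

lemma is_prox_variational:
  assumes "is_prox v p" "w \<in> D"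
  shows "h p \<le> h w + (p - v) \<bullet> (w - p)"
proof -
  have p: "p \<in> D"
    using assms by (simp add: is_prox_def)
  have "h p \<le> h w + (p - v) \<bullet> (w - p) + t / 2 * (norm (w - p))\<^sup>2" if t: "0 < t" "t < 1" for t
  proof -
    have "prox_obj v p \<le> prox_obj v (p + t *\<^sub>R (w - p))"
      using assms t segment_mem[OF p assms(2), of t] by (simp add: is_prox_def)
    moreover have "h (p + t *\<^sub>R (w - p)) \<le> (1 - t) * h p + t * h w"
      using segment_le[OF p assms(2), of t] t by simp
    moreover have "(norm (p + t *\<^sub>R (w - p) - v))\<^sup>2
        = (norm (p - v))\<^sup>2 + 2 * t * ((p - v) \<bullet> (w - p)) + t\<^sup>2 * (norm (w - p))\<^sup>2"
      unfolding power2_norm_eq_inner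
      by (simp add: inner_simps inner_commute algebra_simps power2_eq_square)
    ultimately have "t * h p \<le> t * (h w + (p - v) \<bullet> (w - p) + t / 2 * (norm (w - p))\<^sup>2)"
      by (simp add: prox_obj_def algebra_simps power2_eq_square)
    then show ?thesis
      using t by simp
  qed
  then have "\<forall>\<^sub>F t in at_right 0. h p \<le> h w + (p - v) \<bullet> (w - p) + t / 2 * (norm (w - p))\<^sup>2"
    by (intro eventually_at_rightI[of 0 1]) auto
  moreover have "((\<lambda>t. h w + (p - v) \<bullet> (w - p) + t / 2 * (norm (w - p))\<^sup>2)
      \<longlongrightarrow> h w + (p - v) \<bullet> (w - p) + 0 / 2 * (norm (w - p))\<^sup>2) (at_right 0)"
    by (intro tendsto_intros) simp
  ultimately show ?thesis
    using tendsto_lowerbound by fastforce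
qed

text \<open>In the sum of the two variational inequalities the values of \<open>h\<close> cancel;
  the inner products add up to
  \<open>(p - q) \<bullet> (v - u) - (norm (p - q))\<^sup>2\<close>.\<close>

lemma is_prox_firmly_nonexpansive:
  assumes "is_prox v p" "is_prox u q"
  shows "(norm (p - q))\<^sup>2 \<le> (p - q) \<bullet> (v - u)"
proof -
  have "h p \<le> h q + (p - v) \<bullet> (q - p)" "h q \<le> h p + (q - u) \<bullet> (p - q)"
    using assms is_prox_variational by (auto simp: is_prox_def)
  then have "0 \<le> (p - v) \<bullet> (q - p) + (q - u) \<bullet> (p - q)"
    by linarith
  then show ?thesis
    unfolding power2_norm_eq_inner by (simp add: inner_simps inner_commute algebra_simps)
qed

lemma is_prox_unique:
  assumes "is_prox v p" "is_prox v q"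
  shows "p = q"
  using is_prox_firmly_nonexpansive[OF assms] by simp

section \<open>Existence of minimizers\<close>

lemma minimizing_Cauchy:
  assumes D: "\<And>n. z n \<in> D" and lim: "(\<lambda>n. prox_obj v (z n)) \<longlonglongrightarrow> (INF x\<in>D. prox_obj v x)"
  shows "Cauchy z"
proof (rule metric_CauchyI)
  fix e :: real assume e: "e > 0"
  define m where "m = (INF x\<in>D. prox_obj v x)"
  \<comment> \<open>The margin \<open>e\<^sup>2 / 8\<close> matches the midpoint gain: the midpoint
    has value at least \<open>m\<close>, so two such points are closer than
    \<open>e\<close>.\<close>
  have "\<forall>\<^sub>F n in sequentially. prox_obj v (z n) < m + e\<^sup>2 / 8"
    using e by (intro order_tendstoD(2)[OF lim]) (simp add: m_def)
  then obtain N where N: "\<And>n. n \<ge> N \<Longrightarrow> prox_obj v (z n) < m + e\<^sup>2 / 8"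
    by (auto simp: eventually_sequentially)
  have "dist (z i) (z j) < e" if "i \<ge> N" "j \<ge> N" for i j
  proof -
    have "midpoint (z i) (z j) \<in> D"
      using segment_mem[OF D[of i] D[of j], of "1/2"]
      by (simp add: midpoint_eq_segment)
    then have "m \<le> prox_obj v (midpoint (z i) (z j))"
      unfolding m_def by (intro cINF_lower bdd_below_prox_obj)
    then have "(norm (z i - z j))\<^sup>2 < e\<^sup>2"
      using prox_obj_midpoint[OF D[of i] D[of j], of v] N[OF that(1)] N[OF that(2)] by argo
    then show ?thesis
      using e by (simp add: dist_norm power_less_imp_less_base)
  qed
  then show "\<exists>N. \<forall>i\<ge>N. \<forall>j\<ge>N. dist (z i) (z j) < e"
    by blast
qed

text \<open>Removing the convergent quadratic term shows that \<open>h (z n)\<close> converges. The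
  limit of the graph points lies in the closed epigraph, which yields both \<open>p \<in> D\<close>
  and the bound on \<open>h p\<close>.\<close>

lemma minimizing_limit:
  assumes D: "\<And>n. z n \<in> D" and lim: "(\<lambda>n. prox_obj v (z n)) \<longlonglongrightarrow> (INF x\<in>D. prox_obj v x)"
    and "z \<longlonglongrightarrow> p"
  shows "is_prox v p"
proof -
  let ?m = "INF x\<in>D. prox_obj v x"
  have "(\<lambda>n. prox_obj v (z n) - 1/2 * (norm (z n - v))\<^sup>2) \<longlonglongrightarrow> ?m - 1/2 * (norm (p - v))\<^sup>2"
    by (intro tendsto_intros assms)
  then have "(\<lambda>n. (z n, h (z n))) \<longlonglongrightarrow> (p, ?m - 1/2 * (norm (p - v))\<^sup>2)"
    using assms(3) by (intro tendsto_Pair) (simp_all add: prox_obj_def)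
  then have "(p, ?m - 1/2 * (norm (p - v))\<^sup>2) \<in> {(x, r). x \<in> D \<and> h x \<le> r}"
    by (rule closed_sequentially[OF closed_epigraph, rotated]) (simp add: D)
  then have "p \<in> D" "prox_obj v p \<le> ?m"
    by (simp_all add: prox_obj_def)
  then show ?thesis
    using cINF_lower[OF bdd_below_prox_obj, of _ v] by (fastforce simp: is_prox_def)
qed

lemma is_prox_exists:
  assumes "complete (UNIV :: 'a set)"
  obtains p where "is_prox v p"
proof -
  let ?m = "INF x\<in>D. prox_obj v x"
  have "\<exists>x\<in>D. prox_obj v x < ?m + inverse (real (Suc n))" for n
    using nonempty by (subst cINF_less_iff[symmetric]) (auto simp: bdd_below_prox_obj)
  then obtain z where z: "\<And>n. z n \<in> D" "\<And>n. prox_obj v (z n) < ?m + inverse (real (Suc n))"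
    by metis
  have lim: "(\<lambda>n. prox_obj v (z n)) \<longlonglongrightarrow> ?m"
  proof (rule tendsto_sandwich)
    show "\<forall>\<^sub>F n in sequentially. ?m \<le> prox_obj v (z n)"
      by (intro always_eventually allI cINF_lower bdd_below_prox_obj z)
    show "\<forall>\<^sub>F n in sequentially. prox_obj v (z n) \<le> ?m + inverse (real (Suc n))"
      by (intro always_eventually allI less_imp_le z)
    show "(\<lambda>n. ?m + inverse (real (Suc n))) \<longlonglongrightarrow> ?m"
      using LIMSEQ_inverse_real_of_nat_add by simp
  qed simp
  obtain p where "z \<longlonglongrightarrow> p"
    using assms minimizing_Cauchy[OF z(1) lim] by (auto simp: complete_def)
  then show thesis
    using that minimizing_limit[OF z(1) lim] by blast
qed

end

section \<open>Reduction of extended-valued functions\<close>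

lemma convex_fun_comp_linear:
  assumes "convex_fun f" "linear S"
  shows "convex_fun (\<lambda>z. f (S z))"
  using assms by (simp add: convex_fun_def linear_add linear_scale)

text \<open>The new epigraph is the preimage of the old one under the continuous map
  \<open>(z, r) \<mapsto> (S z, r)\<close>.\<close>

lemma closed_fun_comp_continuous:
  assumes "closed_fun f" "continuous_on UNIV S"
  shows "closed_fun (\<lambda>z. f (S z))"
proof -
  have "continuous_on UNIV (\<lambda>p :: _ \<times> real. (S (fst p), snd p))"
    by (intro continuous_intros continuous_on_compose2[OF assms(2)]) auto
  then have "closed ((\<lambda>p. (S (fst p), snd p)) -` {(x, r::real). f x \<le> ereal r})"
    using assms(1) by (intro closed_vimage) (auto simp: closed_fun_def)
  then show ?thesis
    by (simp add: closed_fun_def vimage_def case_prod_unfold)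
qed

lemma proper_fun_comp_surj:
  assumes "proper_fun f" "surj S"
  shows "proper_fun (\<lambda>z. f (S z))"
  using assms by (metis proper_fun_def surjD)

lemma closed_convex_real_fun_domain:
  assumes "closed_fun g" "convex_fun g" "proper_fun g"
  shows "closed_convex_real_fun {x. g x \<noteq> \<infinity>} (\<lambda>x. real_of_ereal (g x))"
proof
  let ?D = "{x. g x \<noteq> \<infinity>}" and ?h = "\<lambda>x. real_of_ereal (g x)"
  have g: "g x = ereal (?h x)" if "x \<in> ?D" for x
    using that assms(3) by (cases "g x") (auto simp: proper_fun_def)
  have seg: "(1 - t) *\<^sub>R x + t *\<^sub>R y \<in> ?D
      \<and> ?h ((1 - t) *\<^sub>R x + t *\<^sub>R y) \<le> (1 - t) * ?h x + t * ?h y"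
    if "0 < t" "t < 1" "x \<in> ?D" "y \<in> ?D" for t x y
  proof -
    let ?w = "(1 - t) *\<^sub>R x + t *\<^sub>R y"
    have "g ?w \<le> ereal (1 - t) * g x + ereal t * g y"
      using assms(2) that by (auto simp: convex_fun_def)
    also have "\<dots> = ereal ((1 - t) * ?h x + t * ?h y)"
      using g[OF that(3)] g[OF that(4)] by (metis plus_ereal.simps(1) times_ereal.simps(1))
    finally have le: "g ?w \<le> ereal ((1 - t) * ?h x + t * ?h y)" .
    then have "?w \<in> ?D"
      by auto
    with le g[OF this] show ?thesis
      by (metis ereal_less_eq(3))
  qed
  show "?D \<noteq> {}"
    using assms(3) by (auto simp: proper_fun_def)
  \<comment> \<open>\<open>seg\<close> covers the open interval; the endpoints \<open>t = 0\<close>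
    and \<open>t = 1\<close> reduce to \<open>x\<close> and \<open>y\<close>.\<close>
  have "convex ?D"
    unfolding convex_alt using seg by (metis order_le_less diff_zero diff_self scaleR_one
        scaleR_zero_left add_0 add.right_neutral)
  then show "convex_on ?D ?h"
    using seg by (intro convex_onI) auto
  \<comment> \<open>Since \<open>real_of_ereal\<close> sends \<open>\<infinity>\<close> to
    \<open>0\<close>, the condition \<open>x \<in> ?D\<close> has to exclude such points from the
    epigraph.\<close>
  have "x \<in> ?D \<and> ?h x \<le> r \<longleftrightarrow> g x \<le> ereal r" for x r
    using assms(3) by (cases "g x") (auto simp: proper_fun_def)
  then have "{(x, r). x \<in> ?D \<and> ?h x \<le> r} = {(x, r). g x \<le> ereal r}"
    by simp
  then show "closed {(x, r). x \<in> ?D \<and> ?h x \<le> r}"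
    using assms(1) by (simp add: closed_fun_def)
qed

text \<open>The objective is finite on the nonempty domain and infinite off it, so no minimizer over
  the whole space lies outside the domain.\<close>

lemma Prox_eq_is_prox:
  assumes "closed_fun (\<lambda>z. f (S z))" "convex_fun (\<lambda>z. f (S z))" "proper_fun (\<lambda>z. f (S z))"
  shows "Prox f S v = Collect (closed_convex_real_fun.is_prox
    {x. f (S x) \<noteq> \<infinity>} (\<lambda>x. real_of_ereal (f (S x))) v)"
proof -
  let ?D = "{x. f (S x) \<noteq> \<infinity>}" and ?h = "\<lambda>x. real_of_ereal (f (S x))"
  interpret closed_convex_real_fun ?D ?h
    by (rule closed_convex_real_fun_domain[OF assms])
  let ?F = "\<lambda>z. f (S z) + ereal (1/2 * (norm (z - v))\<^sup>2)"
  have fin: "?F z = ereal (prox_obj v z)" if "z \<in> ?D" for z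
  proof -
    have "f (S z) = ereal (?h z)"
      using that assms(3) by (cases "f (S z)") (auto simp: proper_fun_def)
    then show ?thesis
      unfolding prox_obj_def by (metis plus_ereal.simps(1))
  qed
  have inf: "?F z = \<infinity>" if "z \<notin> ?D" for z
    using that by simp
  have "is_arg_min ?F (\<lambda>z. z \<in> UNIV) p \<longleftrightarrow> is_prox v p" for p
  proof
    assume "is_arg_min ?F (\<lambda>z. z \<in> UNIV) p"
    then have min: "?F p \<le> ?F z" for z
      by (simp add: is_arg_min_linorder)
    obtain x where x: "x \<in> ?D"
      using nonempty by blast
    have p: "p \<in> ?D"
      using min[of x] fin[OF x] inf[of p] by (metis ereal_infty_less_eq(1) PInfty_neq_ereal(1))
    have "prox_obj v p \<le> prox_obj v z" if "z \<in> ?D" for z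
      using min[of z] fin[OF p] fin[OF that] by (metis ereal_less_eq(3))
    with p show "is_prox v p"
      by (simp add: is_prox_def)
  next
    assume prox: "is_prox v p"
    have "?F p \<le> ?F z" for z
    proof (cases "z \<in> ?D")
      case True
      then show ?thesis
        using prox fin[of p] fin[OF True] by (metis ereal_less_eq(3) is_prox_def)
    next
      case False
      then show ?thesis
        using inf by (metis ereal_less_eq(1))
    qed
    then show "is_arg_min ?F (\<lambda>z. z \<in> UNIV) p"
      by (simp add: is_arg_min_linorder)
  qed
  then show ?thesis
    by (simp add: Prox_def)
qed

theorem proposition2p2:
  fixes f :: "'h::{real_inner, complete_space} \<Rightarrow> ereal"
    and S :: "'h \<Rightarrow> 'h"
  assumes "closed_fun f" and "convex_fun f" and "proper_fun f"
    and "bij S" and "linear S" and "continuous_on UNIV S"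
  shows "single_valued_op (Prox f S) \<and> firmly_nonexpansive (\<lambda>v. the_elem (Prox f S v))"
proof -
  have comp: "closed_fun (\<lambda>z. f (S z))" "convex_fun (\<lambda>z. f (S z))" "proper_fun (\<lambda>z. f (S z))"
    using assms closed_fun_comp_continuous convex_fun_comp_linear proper_fun_comp_surj bij_is_surj
    by blast+
  interpret closed_convex_real_fun "{x. f (S x) \<noteq> \<infinity>}" "\<lambda>x. real_of_ereal (f (S x))"
    by (rule closed_convex_real_fun_domain[OF comp])
  have Prox: "Prox f S v = Collect (is_prox v)" for v
    using Prox_eq_is_prox[where f=f and S=S] comp by blast
  have "\<exists>p. is_prox v p" for v
    using is_prox_exists complete_UNIV by blast
  then obtain P where P: "\<And>v. is_prox v (P v)"
    by metis
  \<comment> \<open>\<open>the_elem\<close> of this singleton is \<open>P v\<close>, which transfers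
    firm nonexpansiveness from minimizers to the operator.\<close>
  have single: "Prox f S v = {P v}" for v
    using P is_prox_unique by (auto simp: Prox)
  then show ?thesis
    using P is_prox_firmly_nonexpansive
    by (auto simp: single_valued_op_def firmly_nonexpansive_def)
qed

end
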